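(* Let $k\ge1$, $g\ge1$, $n\ge 1$ and $t\ge k$ be integers, $p\in(0,1)$, $q=1-p$. Let $L_n$ be the length of the longest success run (of order $k$ with gap $g$) in $n$ independent Bernoulli trials with success probability $p$ ($L_n=0$ if there is no success run). For nonnegative integers $j_1,j_2,j_3$ put $r=j_1+j_2+j_3$ and $s=n-t-j_1(k+1)-j_2(k+g)-j_3(t+g)$. Then $$P(L_n\ge t)=\sum_{\substack{j_1,j_2,j_3\ge0\\ s\ge0}}(-1)^{j_1+j_3}q^r p^{(j_1+j_2)k+(j_3+1)t}\binom{r}{j_1,j_2,j_3}\left[\binom{s+r+1}{r+1}-p\binom{s+r}{r+1}\right],$$ where the sum is over all triples $(j_1,j_2,j_3)$ of nonnegative integers with $s\ge 0$, and $\binom{r}{j_1,j_2,j_3}=\frac{r!}{j_1!\,j_2!\,j_3!}$.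
   Context: Consider a sequence of $n$ independent trials, each $S$ (success) with probability $p$ or $F$ (failure) with probability $q=1-p$. The success runs (of order $k$ with gap $g$) are defined inductively. The first success run (if it exists) is the first run of at least $k$ consecutive successes, taken maximal (it cannot be extended to a longer run). A success run terminates at trial $m$ if trial $m$ is its last success, i.e. either $m=n$ or trial $m+1$ is a failure. If the $j$-th success run terminates at trial $m$, then the $(j+1)$-th success run (if it exists) is the first run of at least $k$ consecutive successes which begins later than trial $m+g$, taken maximal among runs beginning later than trial $m+g$ (trials $m+1,\dots,m+g$ form the gap: an $F$ followed by $g-1$ arbitrary outcomes). *)

theory Defs
  imports "HOL-Probability.Probability"
begin

text \<open>
  A sequence of outcomes is a function \<open>w :: nat \<Rightarrow> bool\<close>, of which only the trials
  \<open>1, ..., n\<close> matter; \<open>w i\<close> means that trial \<open>i\<close> is a success. A block of trials is given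
  by its first trial \<open>a\<close> and its last trial \<open>b\<close>, so it has length \<open>b + 1 - a\<close>.
\<close>

definition success_block :: "nat \<Rightarrow> (nat \<Rightarrow> bool) \<Rightarrow> nat \<Rightarrow> nat \<Rightarrow> nat \<Rightarrow> bool" where
  "success_block n w l a b \<longleftrightarrow> l < a \<and> a \<le> b \<and> b \<le> n \<and> (\<forall>i\<in>{a..b}. w i)"

text \<open>
  Maximality is relative to the blocks that begin later than trial \<open>l\<close>: such a block may begin
  at trial \<open>l + 1\<close> even if trial \<open>l\<close> is a success.
\<close>

definition maximal_block :: "nat \<Rightarrow> (nat \<Rightarrow> bool) \<Rightarrow> nat \<Rightarrow> nat \<Rightarrow> nat \<Rightarrow> bool" where
  "maximal_block n w l a b \<longleftrightarrow>
     success_block n w l a b \<and>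
     (\<forall>a' b'. success_block n w l a' b' \<and> a' \<le> a \<and> b \<le> b' \<longrightarrow> a' = a \<and> b' = b)"

definition first_run_after :: "nat \<Rightarrow> nat \<Rightarrow> (nat \<Rightarrow> bool) \<Rightarrow> nat \<Rightarrow> nat \<Rightarrow> nat \<Rightarrow> bool" where
  "first_run_after n k w l a b \<longleftrightarrow>
     maximal_block n w l a b \<and> k \<le> b + 1 - a \<and>
     (\<forall>a' b'. maximal_block n w l a' b' \<and> k \<le> b' + 1 - a' \<longrightarrow> a \<le> a')"

text \<open>\<open>success_run n k g w j a b\<close>: the \<open>j\<close>-th success run begins at \<open>a\<close> and terminates at \<open>b\<close>.\<close>

inductive success_run :: "nat \<Rightarrow> nat \<Rightarrow> nat \<Rightarrow> (nat \<Rightarrow> bool) \<Rightarrow> nat \<Rightarrow> nat \<Rightarrow> nat \<Rightarrow> bool"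
  for n k g :: nat and w :: "nat \<Rightarrow> bool" where
  first: "first_run_after n k w 0 a b \<Longrightarrow> success_run n k g w 1 a b"
| gap: "success_run n k g w j a m \<Longrightarrow> first_run_after n k w (m + g) a' b'
          \<Longrightarrow> success_run n k g w (Suc j) a' b'"

text \<open>All runs lie within \<open>1, ..., n\<close>, so the maximum is over a finite set.\<close>

definition longest_run :: "nat \<Rightarrow> nat \<Rightarrow> nat \<Rightarrow> (nat \<Rightarrow> bool) \<Rightarrow> nat" where
  "longest_run n k g w =
     Max (insert 0 {b + 1 - a | a b. \<exists>j. success_run n k g w j a b})"

definition slack :: "nat \<Rightarrow> nat \<Rightarrow> nat \<Rightarrow> nat \<Rightarrow> nat \<Rightarrow> nat \<Rightarrow> nat \<Rightarrow> int" where
  "slack n k g t j1 j2 j3 =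
     int n - int t - int j1 * (int k + 1) - int j2 * (int k + int g) - int j3 * (int t + int g)"

end

(*
  Reading the trials from left to right while counting the successes since the last failure or gap
  turns the event into acceptance by an automaton. Its first-step equations give the generating
  function of P(L_n >= t),
    (p x)^t (1 - p x) / ((1 - x) (1 - x + q p^k x^(k+1) - q p^k x^(k+g) + q p^t x^(t+g))).
  Expanding it as a geometric series in the last three terms of the denominator over 1 - x, with
  exponents j1, j2, j3 for these terms in this order, yields the sum.
*)
theory Submission
  imports Defs "HOL-Computational_Algebra.Formal_Power_Series"
begin

unbundle no vec_syntax
unbundle fps_syntax

section \<open>Success runs counted from an arbitrary starting trial\<close>

text \<open>\<open>success_run\<close> appends each new run at the end, whereas the trials will be
  read from the front. This version peels off the first run and lets the starting trial
  \<open>l\<close> vary, so that what follows the gap is again an instance of the same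
  relation.\<close>

inductive run_from :: "nat \<Rightarrow> nat \<Rightarrow> nat \<Rightarrow> (nat \<Rightarrow> bool) \<Rightarrow> nat \<Rightarrow> nat \<Rightarrow> nat \<Rightarrow> bool"
  for n k g :: nat and w :: "nat \<Rightarrow> bool" where
  here: "first_run_after n k w l a b \<Longrightarrow> run_from n k g w l a b"
| later: "first_run_after n k w l a m \<Longrightarrow> run_from n k g w (m + g) a' b'
          \<Longrightarrow> run_from n k g w l a' b'"

text \<open>The induction carries a continuation: whatever is reachable beyond the gap after a
  success run is also reachable from trial 0.\<close>

lemma success_run_imp_run_from:
  assumes "success_run n k g w j a b"
  shows "run_from n k g w 0 a b"
proof -
  have "run_from n k g w (b + g) a' b' \<longrightarrow> run_from n k g w 0 a' b'"
    if "success_run n k g w j a b" for a' b' j a b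
    using that by (induction arbitrary: a' b') (blast intro: run_from.intros)+
  with assms show ?thesis
    by cases (blast intro: run_from.intros)+
qed

text \<open>The invariant of the induction is that \<open>l\<close> ends the gap after some success
  run, so \<open>success_run.gap\<close> applies at every stage.\<close>

lemma run_from_imp_success_run:
  assumes "run_from n k g w 0 a b"
  shows "\<exists>j. success_run n k g w j a b"
proof -
  have "success_run n k g w j a0 m \<Longrightarrow> l = m + g \<Longrightarrow> \<exists>j. success_run n k g w j a b"
    if "run_from n k g w l a b" for l j a0 m
    using that by (induction arbitrary: j a0 m) (blast intro: success_run.intros)+
  with assms show ?thesis
    by cases (blast intro: success_run.intros)+
qed

definition long_run_after :: "nat \<Rightarrow> nat \<Rightarrow> nat \<Rightarrow> nat \<Rightarrow> (nat \<Rightarrow> bool) \<Rightarrow> nat \<Rightarrow> bool" where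
  "long_run_after n k g t w l \<longleftrightarrow> (\<exists>a b. run_from n k g w l a b \<and> t \<le> b + 1 - a)"

lemma run_from_bounds:
  "run_from n k g w l a b \<Longrightarrow> l < a \<and> a \<le> b \<and> b \<le> n"
proof (induction rule: run_from.induct)
  case (later l a m a' b')
  then show ?case
    unfolding first_run_after_def maximal_block_def success_block_def by linarith
qed (auto simp: first_run_after_def maximal_block_def success_block_def)

lemma long_run_after_bound:
  "long_run_after n k g t w l \<Longrightarrow> l + t \<le> n"
  by (auto simp: long_run_after_def dest!: run_from_bounds)

lemma longest_run_ge_iff:
  assumes "1 \<le> t"
  shows "t \<le> longest_run n k g w \<longleftrightarrow> long_run_after n k g t w 0"
proof -
  let ?A = "{b + 1 - a | a b. \<exists>j. success_run n k g w j a b}"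
  have A: "?A = {b + 1 - a | a b. run_from n k g w 0 a b}"
    using success_run_imp_run_from run_from_imp_success_run by blast
  have "?A \<subseteq> {..n + 1}"
    unfolding A by (auto dest!: run_from_bounds)
  then have "finite ?A"
    using finite_subset by blast
  \<comment> \<open>Since \<open>t\<close> is positive, the inserted 0 cannot witness the
    bound.\<close>
  then show ?thesis
    using assms unfolding longest_run_def A long_run_after_def
    by (subst Max_ge_iff) auto
qed

lemma long_run_after_iff:
  "long_run_after n k g t w l \<longleftrightarrow>
     (\<exists>a m. first_run_after n k w l a m \<and> (t \<le> m + 1 - a \<or> long_run_after n k g t w (m + g)))"
  unfolding long_run_after_def by (subst run_from.simps) blast

section \<open>Local description of maximal blocks and of the first run\<close>

text \<open>A strictly larger block contains a neighbouring trial of \<open>a..b\<close>, so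
  one-step extensions decide maximality. On the left the boundary is \<open>Suc l\<close>, whatever
  the outcome of trial \<open>l\<close>.\<close>

lemma maximal_block_iff:
  "maximal_block n w l a b \<longleftrightarrow>
     success_block n w l a b \<and> (a = Suc l \<or> \<not> w (a - 1)) \<and> (b = n \<or> \<not> w (Suc b))"
proof (cases "success_block n w l a b")
  case True
  then have ab: "l < a" "a \<le> b" "b \<le> n" "\<And>i. a \<le> i \<Longrightarrow> i \<le> b \<Longrightarrow> w i"
    by (auto simp: success_block_def)
  have left: "a = Suc l \<or> \<not> w (a - 1)" if m: "maximal_block n w l a b"
  proof (rule ccontr)
    assume h: "\<not> ?thesis"
    have "success_block n w l (a - 1) b"
      unfolding success_block_def
    proof (intro conjI ballI)
      fix i assume "i \<in> {a - 1..b}"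
      then show "w i" using h ab(4)[of i] by (cases "i = a - 1") auto
    qed (use h ab in auto)
    with m ab show False
      unfolding maximal_block_def by fastforce
  qed
  have right: "b = n \<or> \<not> w (Suc b)" if m: "maximal_block n w l a b"
  proof (rule ccontr)
    assume h: "\<not> ?thesis"
    then have "success_block n w l a (Suc b)"
      using ab by (auto simp: success_block_def le_Suc_eq)
    with m show False
      unfolding maximal_block_def by fastforce
  qed
  have "maximal_block n w l a b"
    if h: "a = Suc l \<or> \<not> w (a - 1)" "b = n \<or> \<not> w (Suc b)"
    unfolding maximal_block_def
  proof (intro conjI allI impI)
    fix a' b' assume s: "success_block n w l a' b' \<and> a' \<le> a \<and> b \<le> b'"
    show "a' = a"
    proof (rule ccontr)
      assume "a' \<noteq> a"
      then have "a - 1 \<in> {a'..b'}" "a \<noteq> Suc l" using s ab by (auto simp: success_block_def)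
      then show False using s h by (auto simp: success_block_def)
    qed
    show "b' = b"
    proof (rule ccontr)
      assume "b' \<noteq> b"
      then have "Suc b \<in> {a'..b'}" "b \<noteq> n" using s ab by (auto simp: success_block_def)
      then show False using s h by (auto simp: success_block_def)
    qed
  qed (use True in simp)
  with left right show ?thesis using True by blast
qed (auto simp: maximal_block_def)

lemma first_run_after_unique:
  assumes "first_run_after n k w l a b" "first_run_after n k w l a' b'"
  shows "a' = a \<and> b' = b"
proof -
  have a: "a' = a"
    using assms by (meson first_run_after_def order_antisym)
  have "b' = b"
    using assms unfolding first_run_after_def maximal_block_def a
    by (metis nat_le_linear order_refl)
  with a show ?thesis ..
qed

text \<open>No admissible block begins before \<open>Suc l\<close>, so a block beginning there is
  automatically the first.\<close>

lemma first_run_afterI_start: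
  assumes "Suc l \<le> b" "b \<le> n" "\<And>i. l < i \<Longrightarrow> i \<le> b \<Longrightarrow> w i" "b = n \<or> \<not> w (Suc b)" "k \<le> b - l"
  shows "first_run_after n k w l (Suc l) b"
proof -
  have "success_block n w l (Suc l) b"
    using assms(1-3) by (simp add: success_block_def)
  moreover have "Suc l \<le> a'" if "maximal_block n w l a' b'" for a' b'
    using that by (simp add: maximal_block_def success_block_def)
  ultimately show ?thesis
    using assms(4,5) unfolding first_run_after_def maximal_block_iff by auto
qed

lemma long_run_after_full:
  assumes "l + t \<le> n" "\<And>i. l < i \<Longrightarrow> i \<le> l + t \<Longrightarrow> w i" "k \<le> t" "1 \<le> t"
  shows "long_run_after n k g t w l"
proof -
  \<comment> \<open>The candidates for the last trial when the given successes are prolonged to the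
    right; the largest one ends a maximal block.\<close>
  define B where "B = {b. l + t \<le> b \<and> b \<le> n \<and> (\<forall>i. l < i \<and> i \<le> b \<longrightarrow> w i)}"
  define b where "b = Max B"
  have fin: "finite B" by (rule finite_subset[of _ "{..n}"]) (auto simp: B_def)
  moreover have "l + t \<in> B" using assms by (auto simp: B_def)
  ultimately have b: "b \<in> B" unfolding b_def by (intro Max_in) auto
  have "b = n \<or> \<not> w (Suc b)"
  proof (rule ccontr)
    assume "\<not> ?thesis"
    with b have "Suc b \<in> B" by (auto simp: B_def le_Suc_eq)
    from Max_ge[OF fin this] show False by (simp add: b_def)
  qed
  with b assms have "first_run_after n k w l (Suc l) b"
    by (intro first_run_afterI_start) (auto simp: B_def)
  moreover have "t \<le> b + 1 - Suc l" using b by (auto simp: B_def)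
  ultimately show ?thesis unfolding long_run_after_iff[of n k g t w l] by blast
qed

text \<open>At most \<open>c < k\<close> trials lie between \<open>l\<close> and the failure, so
  every block long enough begins after the failure. There, maximality relative to \<open>l\<close>
  and relative to the failing trial agree.\<close>

lemma long_run_after_skip:
  assumes "\<not> w (Suc (l + c))" "c < k"
  shows "long_run_after n k g t w l \<longleftrightarrow> long_run_after n k g t w (Suc (l + c))"
proof -
  let ?M = "\<lambda>l a b. maximal_block n w l a b \<and> k \<le> b + 1 - a"
  have start: "Suc (l + c) < a" if "?M l a b" for a b
  proof (rule ccontr)
    assume "\<not> ?thesis"
    with that assms(2) have "Suc (l + c) \<in> {a..b}"
      by (simp add: maximal_block_def success_block_def) linarith
    with that assms(1) show False
      unfolding maximal_block_def success_block_def by blast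
  qed
  have eq: "maximal_block n w l a b \<longleftrightarrow> maximal_block n w (Suc (l + c)) a b"
    if "Suc (l + c) < a" for a b
  \<comment> \<open>Only this position differs: relative to \<open>l\<close> the block is stopped on
    the left by the failure, relative to \<open>Suc (l + c)\<close> by the start.\<close>
  proof (cases "a = Suc (Suc (l + c))")
    case True
    then show ?thesis using assms(1) by (simp add: maximal_block_iff success_block_def)
  next
    case False
    then show ?thesis using that by (simp add: maximal_block_iff success_block_def)
  qed
  have M: "?M l a b \<longleftrightarrow> ?M (Suc (l + c)) a b" for a b
  proof (cases "Suc (l + c) < a")
    case True
    then show ?thesis using eq by simp
  next
    case False
    then show ?thesis using start[of a b] by (auto simp: maximal_block_def success_block_def)
  qed
  have "first_run_after n k w l' a b \<longleftrightarrow> ?M l' a b \<and> (\<forall>a' b'. ?M l' a' b' \<longrightarrow> a \<le> a')" for l' a b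
    by (simp add: first_run_after_def)
  then have "first_run_after n k w l = first_run_after n k w (Suc (l + c))"
    by (intro ext) (simp only: M)
  then show ?thesis
    unfolding long_run_after_iff[of n k g t w l] long_run_after_iff[of n k g t w "Suc (l + c)"] by simp
qed

text \<open>The \<open>c\<close> successes form the first run. It is shorter than \<open>t\<close>,
  so a long run has to come from beyond its gap, which begins with the failing trial.\<close>

lemma long_run_after_gap:
  assumes "\<And>i. l < i \<Longrightarrow> i \<le> l + c \<Longrightarrow> w i" "\<not> w (Suc (l + c))" "k \<le> c" "1 \<le> k" "c < t" "l + c < n"
  shows "long_run_after n k g t w l \<longleftrightarrow> long_run_after n k g t w (l + c + g)"
proof -
  have "first_run_after n k w l (Suc l) (l + c)"
    using assms by (intro first_run_afterI_start) auto
  then show ?thesis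
    using assms(5) first_run_after_unique[of n k w l "Suc l" "l + c"]
    unfolding long_run_after_iff[of n k g t w l] by (metis Suc_eq_plus1 add_Suc diff_add_inverse diff_Suc_Suc not_le)
qed

section \<open>The automaton reading the trials\<close>

text \<open>The argument \<open>c\<close> counts the successes since the last failure or gap.\<close>

function hit :: "nat \<Rightarrow> nat \<Rightarrow> nat \<Rightarrow> nat \<Rightarrow> bool list \<Rightarrow> bool" where
  "hit k g t c [] = False"
| "hit k g t c (True # xs) = (t \<le> Suc c \<or> hit k g t (Suc c) xs)"
| "hit k g t c (False # xs) = hit k g t 0 (if c < k then xs else drop (g - 1) xs)"
  by pat_completeness auto
termination by (relation "Wellfounded.measure (\<lambda>(_, _, _, _, xs). length xs)") auto

text \<open>Trial \<open>l\<close> is where the current search began and trial \<open>l + c\<close>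
  is the last one read. The induction is on the number of unread trials; a success keeps
  \<open>l\<close> and raises \<open>c\<close>, a failure moves \<open>l\<close> and resets
  \<open>c\<close>.\<close>

lemma long_run_after_iff_hit:
  assumes "1 \<le> k" "k \<le> t" "1 \<le> g"
  shows "c < t \<Longrightarrow> (\<And>i. l < i \<Longrightarrow> i \<le> l + c \<Longrightarrow> w i) \<Longrightarrow>
    long_run_after n k g t w l \<longleftrightarrow> hit k g t c (map w [Suc (l + c)..<Suc n])"
proof (induction "n - (l + c)" arbitrary: l c rule: less_induct)
  case less
  show ?case
  proof (cases "l + c < n")
    case False
    \<comment> \<open>All trials are read and \<open>c < t\<close>, so fewer than \<open>t\<close>
      trials lie after \<open>l\<close>.\<close>
    then show ?thesis using less.prems(1) long_run_after_bound[of n k g t w l] by auto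
  next
    case True
    then have upt: "[Suc (l + c)..<Suc n] = Suc (l + c) # [Suc (Suc (l + c))..<Suc n]"
      by (intro upt_conv_Cons) simp
    show ?thesis
    proof (cases "w (Suc (l + c))")
      case w: True
      have ww: "w i" if "l < i" "i \<le> l + Suc c" for i
        using that w less.prems(2)[of i] by (cases "i = Suc (l + c)") auto
      show ?thesis
      proof (cases "t \<le> Suc c")
        case t: True
        then have "long_run_after n k g t w l"
          using True less.prems(1) ww assms by (intro long_run_after_full) auto
        then show ?thesis using t w by (simp add: upt del: upt_Suc)
      next
        case False
        then have "long_run_after n k g t w l \<longleftrightarrow> hit k g t (Suc c) (map w [Suc (l + Suc c)..<Suc n])"
          using True ww by (intro less.hyps) auto
        then show ?thesis using False w by (simp add: upt del: upt_Suc)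
      qed
    next
      case w: False
      show ?thesis
      proof (cases "c < k")
        case c: True
        have "long_run_after n k g t w (Suc (l + c)) \<longleftrightarrow>
            hit k g t 0 (map w [Suc (Suc (l + c) + 0)..<Suc n])"
          using True less.prems(1) by (intro less.hyps) auto
        then show ?thesis
          using long_run_after_skip[of w l c k n g t] w c by (simp add: upt del: upt_Suc)
      next
        case c: False
        have "long_run_after n k g t w (l + c + g) \<longleftrightarrow>
            hit k g t 0 (map w [Suc (l + c + g + 0)..<Suc n])"
          using True less.prems(1) assms by (intro less.hyps) auto
        \<comment> \<open>The failure just read is already the first trial of the gap, hence
          \<open>g - 1\<close>.\<close>
        moreover have "drop (g - 1) (map w [Suc (Suc (l + c))..<Suc n]) = map w [Suc (l + c + g)..<Suc n]"
          using assms by (simp add: drop_map drop_upt del: upt_Suc)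
        ultimately show ?thesis
          using long_run_after_gap[of l c w k t n g] less.prems True w c assms
          by (simp add: upt del: upt_Suc)
      qed
    qed
  qed
qed

section \<open>The Bernoulli law on words\<close>

primrec word_prob :: "real \<Rightarrow> nat \<Rightarrow> (bool list \<Rightarrow> bool) \<Rightarrow> real" where
  "word_prob p 0 Q = of_bool (Q [])"
| "word_prob p (Suc n) Q =
     p * word_prob p n (\<lambda>xs. Q (True # xs)) + (1 - p) * word_prob p n (\<lambda>xs. Q (False # xs))"

lemma word_prob_const: "word_prob p n (\<lambda>_. b) = of_bool b"
  by (induction n) (auto simp: algebra_simps)

text \<open>Averaging over an ignored letter changes nothing because the two weights add up to
  1.\<close>

lemma word_prob_drop: "word_prob p n (\<lambda>xs. Q (drop d xs)) = word_prob p (n - d) Q"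
proof (induction n arbitrary: d Q)
  case (Suc n)
  show ?case
    by (cases d) (simp_all add: Suc algebra_simps)
qed simp

text \<open>Fixing the first \<open>l\<close> outcomes makes the recursion of
  \<open>word_prob\<close> match a case split on trial \<open>Suc l\<close>. Independence enters
  only at \<open>m = 0\<close>, where all outcomes are prescribed.\<close>

lemma (in prob_space) prob_prefix_word:
  assumes indep: "indep_vars (\<lambda>_. count_space UNIV) X {1..n}"
    and p: "\<And>i. i \<in> {1..n} \<Longrightarrow> prob {\<omega> \<in> space M. X i \<omega>} = p"
  shows "l + m = n \<Longrightarrow>
    {\<omega> \<in> space M. (\<forall>i\<in>{1..l}. X i \<omega> = v i) \<and> Q (map (\<lambda>i. X i \<omega>) [Suc l..<Suc n])} \<in> events \<and>
    prob {\<omega> \<in> space M. (\<forall>i\<in>{1..l}. X i \<omega> = v i) \<and> Q (map (\<lambda>i. X i \<omega>) [Suc l..<Suc n])}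
      = (\<Prod>i\<in>{1..l}. if v i then p else 1 - p) * word_prob p m Q"
proof (induction m arbitrary: l v Q)
  case 0
  have rv: "random_variable (count_space UNIV) (X i)" if "i \<in> {1..n}" for i
    using indep that by (auto simp: indep_vars_def)
  have ev: "{\<omega> \<in> space M. X i \<omega> = b} \<in> events" if "i \<in> {1..n}" for i b
    using measurable_sets[OF rv[OF that], of "{b}"] by (simp add: vimage_def Int_def conj_commute)
  have single: "prob {\<omega> \<in> space M. X i \<omega> = b} = (if b then p else 1 - p)" if i: "i \<in> {1..n}" for i b
  proof (cases b)
    case False
    have "{\<omega> \<in> space M. X i \<omega> = b} = space M - {\<omega> \<in> space M. X i \<omega>}"
      using False by auto
    then show ?thesis
      using False ev[OF i, of True] p[OF i] by (simp add: prob_compl)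
  qed (use p[OF i] in simp)
  let ?S = "{\<omega> \<in> space M. \<forall>i\<in>{1..l}. X i \<omega> = v i}"
  have S: "?S \<in> events"
    using ev 0 by (intro sets.sets_Collect_finite_All) auto
  have "prob ?S = (\<Prod>i\<in>{1..l}. if v i then p else 1 - p)"
  \<comment> \<open>The product rule is applied to a nonempty set of indices; the empty prefix gives
    the whole space.\<close>
  proof (cases "l = 0")
    case True
    then show ?thesis by (simp add: prob_space)
  next
    case False
    then have "prob (\<Inter>i\<in>{1..n}. X i -` {v i} \<inter> space M) =
        (\<Prod>i\<in>{1..n}. prob (X i -` {v i} \<inter> space M))"
      using 0 by (intro indep_varsD_finite[OF indep]) auto
    moreover have "(\<Inter>i\<in>{1..n}. X i -` {v i} \<inter> space M) = ?S"
      using 0 False by auto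
    moreover have "X i -` {v i} \<inter> space M = {\<omega> \<in> space M. X i \<omega> = v i}" for i
      by auto
    ultimately show ?thesis
      using 0 single by (auto intro!: prod.cong)
  qed
  with S 0 show ?case
    by (cases "Q []") auto
next
  case (Suc m)
  let ?E = "\<lambda>l v Q. {\<omega> \<in> space M. (\<forall>i\<in>{1..l}. X i \<omega> = v i) \<and> Q (map (\<lambda>i. X i \<omega>) [Suc l..<Suc n])}"
  let ?W = "\<lambda>v l. \<Prod>i\<in>{1..l}. if v i then p else 1 - p"
  define E where "E b = ?E (Suc l) (v(Suc l := b)) (\<lambda>xs. Q (b # xs))" for b
  have IH: "E b \<in> events \<and>
      prob (E b) = ?W (v(Suc l := b)) (Suc l) * word_prob p m (\<lambda>xs. Q (b # xs))" for b
    unfolding E_def using Suc.prems by (intro Suc.IH) simp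
  have W: "?W (v(Suc l := b)) (Suc l) = ?W v l * (if b then p else 1 - p)" for b
  proof -
    have "?W (v(Suc l := b)) l = ?W v l" by (intro prod.cong) auto
    then show ?thesis by simp
  qed
  have upt: "[Suc l..<Suc n] = Suc l # [Suc (Suc l)..<Suc n]"
    using Suc.prems by (intro upt_conv_Cons) simp
  have split: "?E l v Q = E True \<union> E False"
  proof (rule set_eqI)
    fix \<omega>
    have *: "(\<forall>i\<in>{1..Suc l}. X i \<omega> = (v(Suc l := b)) i) \<longleftrightarrow>
        (\<forall>i\<in>{1..l}. X i \<omega> = v i) \<and> X (Suc l) \<omega> = b" for b
      by (auto simp: atLeastAtMostSuc_conv)
    show "\<omega> \<in> ?E l v Q \<longleftrightarrow> \<omega> \<in> E True \<union> E False"
      unfolding E_def upt mem_Collect_eq Un_iff * by (cases "X (Suc l) \<omega>") (auto simp del: upt_Suc)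
  qed
  have "X (Suc l) \<omega> = b" if "\<omega> \<in> E b" for \<omega> b
    using that unfolding E_def by force
  then have "E True \<inter> E False = {}"
    by blast
  then have "prob (?E l v Q) = prob (E True) + prob (E False)"
    unfolding split using IH by (intro finite_measure_Union) auto
  then have "prob (?E l v Q) = ?W v l * word_prob p (Suc m) Q"
    using IH[of True] IH[of False] unfolding W by (simp add: algebra_simps del: upt_Suc)
  moreover have "?E l v Q \<in> events"
    unfolding split using IH by auto
  ultimately show ?case by blast
qed

lemma (in prob_space) prob_word:
  assumes "indep_vars (\<lambda>_. count_space UNIV) X {1..n}"
    and "\<And>i. i \<in> {1..n} \<Longrightarrow> prob {\<omega> \<in> space M. X i \<omega>} = p"
  shows "prob {\<omega> \<in> space M. Q (map (\<lambda>i. X i \<omega>) [1..<Suc n])} = word_prob p n Q"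
  using prob_prefix_word[OF assms, of 0 n "\<lambda>_. True" Q] by (simp del: upt_Suc)

section \<open>Generating functions of the acceptance probabilities\<close>

definition hit_gf :: "real \<Rightarrow> nat \<Rightarrow> nat \<Rightarrow> nat \<Rightarrow> nat \<Rightarrow> real fps" where
  "hit_gf p k g t c = Abs_fps (\<lambda>n. word_prob p n (hit k g t c))"

text \<open>The expansion of \<open>1 / (1 - X) ^ (r + 1)\<close>.\<close>

definition binom_fps :: "nat \<Rightarrow> real fps" where
  "binom_fps r = Abs_fps (\<lambda>s. real ((s + r) choose r))"

text \<open>Pascal's rule, coefficient by coefficient.\<close>

lemma one_minus_X_times_binom_fps: "(1 - fps_X) * binom_fps (Suc r) = binom_fps r"
proof (rule fps_ext)
  fix n show "((1 - fps_X) * binom_fps (Suc r)) $ n = binom_fps r $ n"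
    by (cases n) (auto simp: binom_fps_def left_diff_distrib)
qed

text \<open>First-step analysis. Acceptance contributes \<open>binom_fps 0\<close>, the series of
  the constant 1, and a failure that ends a run consumes its whole gap at once, hence the power
  \<open>g\<close>.\<close>

lemma hit_gf_step:
  assumes "1 \<le> g"
  shows "hit_gf p k g t c =
    fps_const p * fps_X * (if t \<le> Suc c then binom_fps 0 else hit_gf p k g t (Suc c)) +
    fps_const (1 - p) * fps_X ^ (if c < k then 1 else g) * hit_gf p k g t 0"
  (is "_ = ?R")
proof (rule fps_ext)
  fix n
  show "hit_gf p k g t c $ n = ?R $ n"
  proof (cases n)
    case 0
    then show ?thesis using assms by (simp add: hit_gf_def)
  next
    case (Suc m)
    have T: "word_prob p m (\<lambda>xs. hit k g t c (True # xs)) =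
        (if t \<le> Suc c then binom_fps 0 else hit_gf p k g t (Suc c)) $ m"
      by (simp add: hit_gf_def binom_fps_def word_prob_const)
    \<comment> \<open>If the gap overruns the end, truncated subtraction leaves the empty word,
      which \<open>hit\<close> rejects; this matches the zero coefficient below degree
      \<open>g\<close>.\<close>
    have F: "word_prob p m (\<lambda>xs. hit k g t c (False # xs)) =
        (fps_X ^ (if c < k then 1 else g) * hit_gf p k g t 0) $ n"
      using assms Suc word_prob_drop[of p m "hit k g t 0" "g - 1"]
      by (auto simp: hit_gf_def fps_X_power_mult_nth)
    have "?R $ n = p * (if t \<le> Suc c then binom_fps 0 else hit_gf p k g t (Suc c)) $ m +
        (1 - p) * (fps_X ^ (if c < k then 1 else g) * hit_gf p k g t 0) $ n"
      by (simp only: fps_add_nth mult.assoc fps_mult_left_const_nth Suc fps_X_mult_nth nat.distinct if_False diff_Suc_1)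
    then show ?thesis
      unfolding T[symmetric] F[symmetric] by (simp add: Suc hit_gf_def)
  qed
qed

text \<open>The geometric sum of the iterated recurrence is kept multiplied by \<open>1 - y\<close>,
  which avoids division in the ring.\<close>

lemma affine_recurrence:
  fixes h :: "nat \<Rightarrow> 'a :: comm_ring_1"
  assumes "\<And>i. i < d \<Longrightarrow> h (Suc i) = y * h i + z"
  shows "(1 - y) * h d = y ^ d * ((1 - y) * h 0) + (1 - y ^ d) * z"
  using assms
proof (induction d)
  case (Suc d)
  have "(1 - y) * h (Suc d) = y * ((1 - y) * h d) + (1 - y) * z"
    using Suc.prems[of d] by (simp add: algebra_simps)
  also have "(1 - y) * h d = y ^ d * ((1 - y) * h 0) + (1 - y ^ d) * z"
    using Suc by simp
  finally show ?case by (simp add: algebra_simps)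
qed simp

text \<open>Chosen so that \<open>1 - fps_X - gap_poly p k g t\<close> is the second factor of the
  denominator; the bracketing is that of \<open>trinomial\<close>.\<close>

definition gap_poly :: "real \<Rightarrow> nat \<Rightarrow> nat \<Rightarrow> nat \<Rightarrow> real fps" where
  "gap_poly p k g t = fps_const (- (1 - p) * p ^ k) * fps_X ^ (k + 1)
     + (fps_const ((1 - p) * p ^ k) * fps_X ^ (k + g)
     + fps_const (- (1 - p) * p ^ t) * fps_X ^ (t + g))"

text \<open>The failure term of the first-step equations is \<open>a\<close> for all counts below
  \<open>k\<close> and \<open>b\<close> for all counts from \<open>k\<close> to
  \<open>t - 1\<close>. Two affine recurrences, from \<open>t\<close> down to \<open>k\<close> and
  from \<open>k\<close> down to 0, therefore solve the system.\<close>

lemma hit_gf_0: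
  assumes "1 \<le> g" "k \<le> t" "1 \<le> k"
  shows "hit_gf p k g t 0 * (1 - fps_X - gap_poly p k g t) =
    fps_const (p ^ t) * fps_X ^ t * (1 - fps_const p * fps_X) * binom_fps 0"
proof -
  define y :: "real fps" where "y = fps_const p * fps_X"
  define H where "H = hit_gf p k g t 0"
  define a where "a = fps_const (1 - p) * fps_X * H"
  define b where "b = fps_const (1 - p) * fps_X ^ g * H"
  \<comment> \<open>Acceptance becomes the boundary value at count \<open>t\<close>.\<close>
  define G where "G c = (if t \<le> c then binom_fps 0 else hit_gf p k g t c)" for c
  have G: "G c = y * G (Suc c) + (if c < k then a else b)" if "c < t" for c
    using hit_gf_step[OF assms(1), of p k t c] that unfolding G_def y_def a_def b_def H_def by simp
  have late: "(1 - y) * G k = y ^ (t - k) * ((1 - y) * binom_fps 0) + (1 - y ^ (t - k)) * b"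
  proof -
    have "(1 - y) * G (t - (t - k)) = y ^ (t - k) * ((1 - y) * G (t - 0)) + (1 - y ^ (t - k)) * b"
    proof (rule affine_recurrence)
      fix i assume "i < t - k"
      moreover from this have "\<not> t - Suc i < k" by simp
      ultimately show "G (t - Suc i) = y * G (t - i) + b"
        using G[of "t - Suc i"] by (simp add: Suc_diff_Suc)
    qed
    moreover have "G t = binom_fps 0" by (simp add: G_def)
    ultimately show ?thesis using assms by simp
  qed
  have early: "(1 - y) * H = y ^ k * ((1 - y) * G k) + (1 - y ^ k) * a"
  proof -
    have "(1 - y) * G (k - k) = y ^ k * ((1 - y) * G (k - 0)) + (1 - y ^ k) * a"
    proof (rule affine_recurrence)
      fix i assume "i < k"
      then show "G (k - Suc i) = y * G (k - i) + a"
        using G[of "k - Suc i"] assms by (simp add: Suc_diff_Suc)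
    qed
    moreover have "G 0 = H" using assms by (simp add: G_def H_def)
    ultimately show ?thesis by simp
  qed
  have "y ^ k * y ^ (t - k) = y ^ t"
    using assms by (simp flip: power_add)
  then have "(1 - y) * H = y ^ t * ((1 - y) * binom_fps 0) + (y ^ k - y ^ t) * b + (1 - y ^ k) * a"
    unfolding early late by (simp add: distrib_left right_diff_distrib left_diff_distrib flip: mult.assoc)
  \<comment> \<open>Both \<open>a\<close> and \<open>b\<close> are multiples of the unknown
    \<open>H\<close>, so this is a linear equation for it.\<close>
  then have eq: "H * (1 - y - fps_const (1 - p) * (fps_X ^ g * (y ^ k - y ^ t) + fps_X * (1 - y ^ k))) =
      y ^ t * (1 - y) * binom_fps 0"
    unfolding a_def b_def by (simp add: algebra_simps)
  have y: "y ^ m = fps_const (p ^ m) * fps_X ^ m" for m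
    by (simp add: y_def power_mult_distrib)
  have "1 - y - fps_const (1 - p) * (fps_X ^ g * (y ^ k - y ^ t) + fps_X * (1 - y ^ k)) =
      1 - fps_X - gap_poly p k g t"
    unfolding gap_poly_def y unfolding y_def
      fps_const_sub[symmetric] fps_const_mult[symmetric] fps_const_neg[symmetric] fps_const_1_eq_1
    by (simp add: algebra_simps power_add del: fps_const_sub fps_const_mult fps_const_neg)
  with eq show ?thesis unfolding y H_def by (simp only: y_def)
qed

section \<open>Series expansion and extraction of coefficients\<close>

text \<open>A finite geometric series with explicit remainder: multiplying by
  \<open>1 - fps_X\<close> lowers the index of \<open>binom_fps\<close>, so the sum
  telescopes.\<close>

lemma geometric_expansion:
  "(\<Sum>r\<le>N. Y ^ r * binom_fps (Suc r)) * (1 - fps_X - Y) = binom_fps 0 - Y ^ Suc N * binom_fps (Suc N)"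
proof -
  have "(\<Sum>r\<le>N. Y ^ r * binom_fps (Suc r)) * (1 - fps_X - Y) =
      (\<Sum>r\<le>N. Y ^ r * ((1 - fps_X) * binom_fps (Suc r)) - Y ^ Suc r * binom_fps (Suc r))"
    unfolding sum_distrib_right by (intro sum.cong) (simp_all add: algebra_simps)
  also have "\<dots> = (\<Sum>r\<le>N. Y ^ r * binom_fps r - Y ^ Suc r * binom_fps (Suc r))"
    by (simp only: one_minus_X_times_binom_fps)
  also have "\<dots> = Y ^ 0 * binom_fps 0 - Y ^ Suc N * binom_fps (Suc N)"
    by (rule sum_telescope)
  finally show ?thesis by simp
qed

text \<open>The remainder after \<open>n\<close> powers carries the factor
  \<open>fps_X ^ Suc n\<close> and so does not reach coefficient \<open>n\<close>.\<close>

lemma fps_nth_div_one_minus_X_minus: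
  assumes eq: "H * (1 - fps_X - fps_X * Z) = P * binom_fps 0"
  shows "H $ n = (\<Sum>r\<le>n. (P * (fps_X * Z) ^ r * binom_fps (Suc r)) $ n)"
proof -
  let ?D = "1 - fps_X - fps_X * Z"
  let ?S = "\<Sum>r\<le>n. (fps_X * Z) ^ r * binom_fps (Suc r)"
  let ?R = "(fps_X * Z) ^ Suc n * binom_fps (Suc n)"
  have D: "inverse ?D * ?D = 1"
    by (intro inverse_mult_eq_1) simp
  have "H = H * ?D * inverse ?D"
    using D by (simp add: ac_simps)
  also have "H * ?D = P * (?S * ?D + ?R)"
    unfolding eq geometric_expansion by (simp only: diff_add_cancel)
  also have "P * (?S * ?D + ?R) * inverse ?D = P * ?S * (inverse ?D * ?D) + P * ?R * inverse ?D"
    by (simp only: algebra_simps)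
  also have "P * ?R * inverse ?D = fps_X ^ Suc n * (Z ^ Suc n * P * binom_fps (Suc n) * inverse ?D)"
    by (simp only: power_mult_distrib ac_simps)
  finally have "H = P * ?S + fps_X ^ Suc n * (Z ^ Suc n * P * binom_fps (Suc n) * inverse ?D)"
    by (simp only: D mult_1_right)
  then have "H $ n = (P * ?S) $ n"
    by (simp only: fps_add_nth fps_X_power_mult_nth) simp
  also have "\<dots> = (\<Sum>r\<le>n. (P * (fps_X * Z) ^ r * binom_fps (Suc r)) $ n)"
    by (simp add: sum_distrib_left fps_sum_nth mult.assoc)
  finally show ?thesis .
qed

lemma trinomial:
  fixes u v w :: "'a :: comm_ring_1"
  shows "(u + (v + w)) ^ r =
    (\<Sum>(i, j, l) \<in> {(i, j, l). i + j + l = r}. of_nat ((r choose i) * ((r - i) choose j)) * u ^ i * v ^ j * w ^ l)"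
proof -
  have "(u + (v + w)) ^ r =
      (\<Sum>i\<le>r. \<Sum>j\<le>r - i. of_nat ((r choose i) * ((r - i) choose j)) * u ^ i * v ^ j * w ^ (r - i - j))"
    by (simp add: binomial_ring sum_distrib_left ac_simps)
  also have "\<dots> = (\<Sum>(i, j) \<in> (SIGMA i:{..r}. {..r - i}).
      of_nat ((r choose i) * ((r - i) choose j)) * u ^ i * v ^ j * w ^ (r - i - j))"
    by (rule sum.Sigma) auto
  also have "\<dots> = (\<Sum>(i, j, l) \<in> {(i, j, l). i + j + l = r}.
      of_nat ((r choose i) * ((r - i) choose j)) * u ^ i * v ^ j * w ^ l)"
    by (rule sum.reindex_bij_witness[where i = "\<lambda>(i, j, l). (i, j)" and j = "\<lambda>(i, j). (i, j, r - i - j)"]) auto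
  finally show ?thesis .
qed

lemma trinomial_coeff:
  "real (((i + j + l) choose i) * ((i + j + l - i) choose j)) = fact (i + j + l) / (fact i * fact j * fact l)"
proof -
  have "real ((i + j + l) choose i) = fact (i + j + l) / (fact i * fact (j + l))"
    using binomial_fact[of i "i + j + l", where 'a = real] by (simp add: add.assoc)
  moreover have "real ((j + l) choose j) = fact (j + l) / (fact j * fact l)"
    using binomial_fact[of j "j + l", where 'a = real] by simp
  ultimately show ?thesis by (simp add: add.assoc)
qed

text \<open>With \<open>g\<close> positive, all three exponents are positive; this factor is what
  truncates the series.\<close>

lemma gap_poly_factor:
  assumes "1 \<le> g"
  shows "\<exists>Z. gap_poly p k g t = fps_X * Z"
proof -
  obtain h where h: "g = Suc h" using assms by (cases g) auto
  have "gap_poly p k g t = fps_X * (fps_const (- (1 - p) * p ^ k) * fps_X ^ k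
     + (fps_const ((1 - p) * p ^ k) * fps_X ^ (k + h)
     + fps_const (- (1 - p) * p ^ t) * fps_X ^ (t + h)))"
    unfolding gap_poly_def h add_Suc_right power_Suc add_0_right One_nat_def distrib_left
    by (simp only: mult_ac)
  then show ?thesis ..
qed

definition coeff_term :: "nat \<Rightarrow> nat \<Rightarrow> nat \<Rightarrow> nat \<Rightarrow> real \<Rightarrow> nat \<Rightarrow> nat \<Rightarrow> nat \<Rightarrow> real" where
  "coeff_term n k g t p j1 j2 j3 =
     (let r = j1 + j2 + j3; s = nat (slack n k g t j1 j2 j3) in
         (-1) ^ (j1 + j3) * (1 - p) ^ r * p ^ ((j1 + j2) * k + (j3 + 1) * t)
         * (fact r / (fact j1 * fact j2 * fact j3))
         * (real ((s + r + 1) choose (r + 1)) - p * real ((s + r) choose (r + 1))))"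

text \<open>Constants are gathered in \<open>A\<close> and powers of \<open>fps_X\<close> in
  \<open>fps_X ^ e\<close>, where \<open>n - e\<close> is the slack. The remaining series is
  \<open>1 - p X\<close> over a power of \<open>1 - X\<close> and yields the bracket.\<close>

lemma monomial_coeff:
  "(fps_const (p ^ t) * fps_X ^ t * (1 - fps_const p * fps_X)
     * (of_nat (((j1 + j2 + j3) choose j1) * ((j1 + j2 + j3 - j1) choose j2))
        * (fps_const (- (1 - p) * p ^ k) * fps_X ^ (k + 1)) ^ j1
        * (fps_const ((1 - p) * p ^ k) * fps_X ^ (k + g)) ^ j2
        * (fps_const (- (1 - p) * p ^ t) * fps_X ^ (t + g)) ^ j3)
     * binom_fps (Suc (j1 + j2 + j3))) $ n =
   (if slack n k g t j1 j2 j3 \<ge> 0 then coeff_term n k g t p j1 j2 j3 else 0)"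
  (is "?F $ n = _")
proof -
  define r where "r = j1 + j2 + j3"
  define e where "e = t + j1 * (k + 1) + j2 * (k + g) + j3 * (t + g)"
  define N where "N = (r choose j1) * ((r - j1) choose j2)"
  define A where "A = real N * ((-1) ^ (j1 + j3) * (1 - p) ^ r * p ^ ((j1 + j2) * k + (j3 + 1) * t))"
  have slack: "slack n k g t j1 j2 j3 = int n - int e"
    by (simp add: slack_def e_def algebra_simps)
  have pow: "(fps_const c * fps_X ^ m) ^ j = fps_const (c ^ j) * fps_X ^ (j * m)" for c :: real and m j
    by (simp add: power_mult_distrib power_mult[symmetric] mult.commute)
  \<comment> \<open>The sign comes from the negative coefficients of the first and third terms of
    \<open>gap_poly\<close>.\<close>
  have "real N * (p ^ t * ((- (1 - p) * p ^ k) ^ j1 * (((1 - p) * p ^ k) ^ j2 * (- (1 - p) * p ^ t) ^ j3))) = A"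
  proof -
    have *: "(- (1 - p) * p ^ m) ^ j = (-1) ^ j * (1 - p) ^ j * p ^ (j * m)" for m j
      by (subst power_mult_distrib, subst power_minus) (simp add: power_mult[symmetric] mult.commute)
    have "((1 - p) * p ^ k) ^ j2 = (1 - p) ^ j2 * p ^ (j2 * k)"
      by (simp add: power_mult_distrib power_mult[symmetric] mult.commute)
    then show ?thesis
      unfolding A_def * r_def by (simp add: power_add distrib_right distrib_left mult_ac)
  qed
  then have A: "fps_const A = of_nat N * (fps_const (p ^ t) * (fps_const ((- (1 - p) * p ^ k) ^ j1)
      * (fps_const (((1 - p) * p ^ k) ^ j2) * fps_const ((- (1 - p) * p ^ t) ^ j3))))"
    by (simp only: fps_of_nat[symmetric] fps_const_mult)
  have X: "(fps_X :: real fps) ^ e =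
      fps_X ^ t * (fps_X ^ (j1 * (k + 1)) * (fps_X ^ (j2 * (k + g)) * fps_X ^ (j3 * (t + g))))"
    by (simp only: e_def power_add mult_ac)
  have "?F = of_nat N * (fps_const (p ^ t) * (fps_const ((- (1 - p) * p ^ k) ^ j1)
      * (fps_const (((1 - p) * p ^ k) ^ j2) * fps_const ((- (1 - p) * p ^ t) ^ j3))))
      * (fps_X ^ e * ((1 - fps_const p * fps_X) * binom_fps (Suc r)))"
    unfolding pow N_def[symmetric] r_def[symmetric] X
    by (simp only: mult_ac)
  then have F: "?F = fps_const A * (fps_X ^ e * ((1 - fps_const p * fps_X) * binom_fps (Suc r)))"
    unfolding A .
  \<comment> \<open>For \<open>s = 0\<close> there is no shifted coefficient, in agreement with
    \<open>r choose (r + 1)\<close> being 0.\<close>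
  have B: "((1 - fps_const p * fps_X) * binom_fps (Suc r)) $ s =
      real ((s + r + 1) choose (r + 1)) - p * real ((s + r) choose (r + 1))" for s
    by (cases s) (auto simp: binom_fps_def left_diff_distrib mult.assoc binomial_eq_0)
  have N: "real N = fact r / (fact j1 * fact j2 * fact j3)"
    unfolding N_def r_def by (rule trinomial_coeff)
  show ?thesis
  proof (cases "e \<le> n")
    case True
    have s: "nat (slack n k g t j1 j2 j3) = n - e" "slack n k g t j1 j2 j3 \<ge> 0"
      using True unfolding slack by auto
    have "?F $ n = A * (real ((n - e + r + 1) choose (r + 1)) - p * real ((n - e + r) choose (r + 1)))"
      unfolding F fps_mult_left_const_nth fps_X_power_mult_nth B using True by simp
    also have "\<dots> = coeff_term n k g t p j1 j2 j3"
      unfolding coeff_term_def Let_def s(1) r_def[symmetric] A_def N by (simp only: mult_ac)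
    finally show ?thesis using s(2) by simp
  next
    case False
    then show ?thesis
      unfolding F slack by (simp add: fps_X_power_mult_nth)
  qed
qed

lemma word_prob_hit:
  assumes "1 \<le> g" "k \<le> t" "1 \<le> k"
  shows "word_prob p n (hit k g t 0) =
    (\<Sum>(j1, j2, j3) \<in> {(j1, j2, j3). slack n k g t j1 j2 j3 \<ge> 0}. coeff_term n k g t p j1 j2 j3)"
proof -
  let ?P = "fps_const (p ^ t) * fps_X ^ t * (1 - fps_const p * fps_X)"
  let ?T = "\<lambda>r. {(j1, j2, j3). j1 + j2 + j3 = (r::nat)}"
  let ?f = "\<lambda>(j1, j2, j3). if slack n k g t j1 j2 j3 \<ge> 0 then coeff_term n k g t p j1 j2 j3 else 0"
  let ?S = "{(j1, j2, j3). slack n k g t j1 j2 j3 \<ge> 0}"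
  obtain Z where Z: "gap_poly p k g t = fps_X * Z"
    using gap_poly_factor assms by blast
  have fin: "finite (?T r)" for r
    by (rule finite_subset[of _ "{..r} \<times> {..r} \<times> {..r}"]) auto
  have "hit_gf p k g t 0 $ n = (\<Sum>r\<le>n. (?P * gap_poly p k g t ^ r * binom_fps (Suc r)) $ n)"
    using hit_gf_0[OF assms, of p] unfolding Z
    by (intro fps_nth_div_one_minus_X_minus) simp
  also have "\<dots> = (\<Sum>r\<le>n. sum ?f (?T r))"
  proof (rule sum.cong[OF refl])
    fix r
    have "(?P * gap_poly p k g t ^ r * binom_fps (Suc r)) $ n =
       (\<Sum>(j1, j2, j3) \<in> ?T r. (?P * (of_nat ((r choose j1) * ((r - j1) choose j2))
        * (fps_const (- (1 - p) * p ^ k) * fps_X ^ (k + 1)) ^ j1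
        * (fps_const ((1 - p) * p ^ k) * fps_X ^ (k + g)) ^ j2
        * (fps_const (- (1 - p) * p ^ t) * fps_X ^ (t + g)) ^ j3) * binom_fps (Suc r)) $ n)"
      unfolding gap_poly_def trinomial sum_distrib_left sum_distrib_right fps_sum_nth
      by (simp only: case_prod_unfold)
    also have "\<dots> = sum ?f (?T r)"
    proof (rule sum.cong[OF refl])
      fix x assume "x \<in> ?T r"
      then obtain j1 j2 j3 where x: "x = (j1, j2, j3)" "r = j1 + j2 + j3" by auto
      show "(case x of (j1, j2, j3) \<Rightarrow> (?P * (of_nat ((r choose j1) * ((r - j1) choose j2))
          * (fps_const (- (1 - p) * p ^ k) * fps_X ^ (k + 1)) ^ j1
          * (fps_const ((1 - p) * p ^ k) * fps_X ^ (k + g)) ^ j2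
          * (fps_const (- (1 - p) * p ^ t) * fps_X ^ (t + g)) ^ j3) * binom_fps (Suc r)) $ n) = ?f x"
        unfolding x prod.case by (rule monomial_coeff)
    qed
    finally show "(?P * gap_poly p k g t ^ r * binom_fps (Suc r)) $ n = sum ?f (?T r)" .
  qed
  also have "\<dots> = sum ?f (\<Union>r\<in>{..n}. ?T r)"
    using fin by (intro sum.UNION_disjoint[symmetric]) auto
  \<comment> \<open>Nonnegative slack forces \<open>j1 + j2 + j3\<close> to be at most
    \<open>n\<close>, as each index uses up at least one trial per unit; \<open>?f\<close> vanishes
    on the other triples.\<close>
  also have "\<dots> = sum ?f ?S"
  proof (rule sum.mono_neutral_right)
    show "finite (\<Union>r\<in>{..n}. ?T r)" using fin by auto
    show "?S \<subseteq> (\<Union>r\<in>{..n}. ?T r)"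
    proof
      fix x assume "x \<in> ?S"
      then obtain j1 j2 j3 where x: "x = (j1, j2, j3)" "slack n k g t j1 j2 j3 \<ge> 0" by auto
      have "int j1 * 1 \<le> int j1 * (int k + 1)" "int j2 * 1 \<le> int j2 * (int k + int g)"
          "int j3 * 1 \<le> int j3 * (int t + int g)"
        using assms by (intro mult_left_mono; simp)+
      then have "j1 + j2 + j3 \<le> n"
        using x(2) unfolding slack_def by linarith
      then show "x \<in> (\<Union>r\<in>{..n}. ?T r)" unfolding x by auto
    qed
  qed (auto split: if_splits)
  also have "\<dots> = (\<Sum>(j1, j2, j3) \<in> ?S. coeff_term n k g t p j1 j2 j3)"
    by (rule sum.cong) auto
  finally show ?thesis by (simp add: hit_gf_def)
qed

theorem mainTheorem8:
  fixes M :: "'a measure" and X :: "nat \<Rightarrow> 'a \<Rightarrow> bool"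
    and n k g t :: nat and p q :: real
  assumes "k \<ge> 1" and "g \<ge> 1" and "n \<ge> 1" and "t \<ge> k"
    and "0 < p" and "p < 1" and "q = 1 - p"
    and "prob_space M"
    and "prob_space.indep_vars M (\<lambda>_. count_space UNIV) X {1..n}"
    and "\<And>i. i \<in> {1..n} \<Longrightarrow> measure M {\<omega> \<in> space M. X i \<omega>} = p"
  shows "measure M {\<omega> \<in> space M. longest_run n k g (\<lambda>i. X i \<omega>) \<ge> t} =
    (\<Sum>(j1, j2, j3) \<in> {(j1, j2, j3). slack n k g t j1 j2 j3 \<ge> 0}.
       let r = j1 + j2 + j3; s = nat (slack n k g t j1 j2 j3) in
         (-1) ^ (j1 + j3) * q ^ r * p ^ ((j1 + j2) * k + (j3 + 1) * t)
         * (fact r / (fact j1 * fact j2 * fact j3))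
         * (real ((s + r + 1) choose (r + 1)) - p * real ((s + r) choose (r + 1))))"
proof -
  interpret prob_space M by fact
  have "{\<omega> \<in> space M. longest_run n k g (\<lambda>i. X i \<omega>) \<ge> t} =
      {\<omega> \<in> space M. hit k g t 0 (map (\<lambda>i. X i \<omega>) [1..<Suc n])}"
    using assms(1-4) long_run_after_iff_hit[of k t g 0 0]
    by (simp add: longest_run_ge_iff del: upt_Suc)
  then have "prob {\<omega> \<in> space M. longest_run n k g (\<lambda>i. X i \<omega>) \<ge> t} = word_prob p n (hit k g t 0)"
    using prob_word[OF assms(9,10)] by simp
  also have "\<dots> = (\<Sum>(j1, j2, j3) \<in> {(j1, j2, j3). slack n k g t j1 j2 j3 \<ge> 0}. coeff_term n k g t p j1 j2 j3)"
    using assms by (intro word_prob_hit) auto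
  finally show ?thesis
    unfolding coeff_term_def assms(7) .
qed

end
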